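(* Let $n\geq2$ and $\alpha,\beta\in \mathbb{R}$. Then for all $f\in C_{0}^{\infty}(\mathbb{R}^n\backslash\{0\})$ we have $$\|\triangle f\|^{2}_{L^{2}(\mathbb{R}^n)}\geq (n\alpha-2\beta)\left\|\frac{\nabla f}{|x|}\right\|^{2}_{L^{2}(\mathbb{R}^n)}-\alpha(\alpha+4)\left\|\frac{x\cdot\nabla f}{|x|^{2}}\right\|^{2}_{L^{2}(\mathbb{R}^n)}$$ $$+\big(2(n-4)(\alpha(n-2)-\beta)-2\alpha^{2}(n-2)+\alpha\beta n-\beta^{2}\big)\left\|\frac{f}{|x|^{2}}\right\|^{2}_{L^{2}(\mathbb{R}^n)}.$$
   Context: Here $\nabla=(\partial_{x_1},\ldots,\partial_{x_n})$ is the usual gradient, $\triangle$ the usual Laplacian and $|x|$ the Euclidean norm on $\mathbb{R}^n$. Functions $f$ are complex-valued, smooth and compactly supported in $\mathbb{R}^n\backslash\{0\}$. *)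

theory Defs
  imports "HOL-Analysis.Analysis"
begin

definition partial :: "'n::finite \<Rightarrow> (real^'n \<Rightarrow> 'b::real_normed_vector) \<Rightarrow> real^'n \<Rightarrow> 'b" where
  "partial i f x = vector_derivative (\<lambda>t. f (x + t *\<^sub>R axis i 1)) (at 0)"

definition gradient :: "(real^'n::finite \<Rightarrow> complex) \<Rightarrow> real^'n \<Rightarrow> complex^'n" where
  "gradient f x = (\<chi> i. partial i f x)"

definition laplacian :: "(real^'n::finite \<Rightarrow> complex) \<Rightarrow> real^'n \<Rightarrow> complex" where
  "laplacian f x = (\<Sum>i\<in>UNIV. partial i (partial i f) x)"

text \<open>\<open>x \<cdot> v\<close> for real \<open>x\<close> and complex \<open>v\<close>; bilinear, with no conjugation.\<close>

definition real_dot :: "real^'n::finite \<Rightarrow> complex^'n \<Rightarrow> complex" where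
  "real_dot x v = (\<Sum>i\<in>UNIV. x $ i *\<^sub>R v $ i)"

text \<open>\<open>C\<^sup>k\<close> on an open set. Requiring Frechet differentiability at each stage is the usual
  requirement that all partial derivatives of order at most \<open>k\<close> exist and are continuous; it also
  rules out junk values of \<^const>\<open>vector_derivative\<close>.\<close>

primrec Ck_on :: "nat \<Rightarrow> (real^'n::finite) set \<Rightarrow> (real^'n \<Rightarrow> 'b::real_normed_vector) \<Rightarrow> bool" where
  "Ck_on 0 S f \<longleftrightarrow> continuous_on S f"
| "Ck_on (Suc k) S f \<longleftrightarrow> (\<forall>x\<in>S. f differentiable (at x)) \<and> (\<forall>i. Ck_on k S (partial i f))"

definition smooth_on :: "(real^'n::finite) set \<Rightarrow> (real^'n \<Rightarrow> 'b::real_normed_vector) \<Rightarrow> bool" where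
  "smooth_on S f \<longleftrightarrow> (\<forall>k. Ck_on k S f)"

text \<open>\<open>C\<^sub>0\<^sup>\<infinity>(S)\<close> for open \<open>S\<close>. Elements are total functions, i.e. already extended by zero:
  the support, whose closure is taken in the whole space, must be a compact subset of \<open>S\<close>.\<close>

definition test_functions :: "(real^'n::finite) set \<Rightarrow> (real^'n \<Rightarrow> complex) set" where
  "test_functions S =
    {f. smooth_on S f \<and> compact (closure {x. f x \<noteq> 0}) \<and> closure {x. f x \<noteq> 0} \<subseteq> S}"

text \<open>Meaningful for square-integrable \<open>g\<close> only: otherwise the Bochner integral is \<open>0\<close>. The functions
  obtained below from test functions on the punctured space are continuous with compact support.\<close>

definition L2_norm :: "(real^'n::finite \<Rightarrow> 'b::real_normed_vector) \<Rightarrow> real" where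
  "L2_norm g = sqrt (\<integral>x. (norm (g x))\<^sup>2 \<partial>lborel)"

end

theory Submission
  imports Defs
begin

text \<open>
  Completing a square gives the inequality. Put \<open>b = \<alpha> (n - 2) - \<beta>\<close> and
  \<open>T f = \<triangle>f + \<alpha> (x \<cdot> \<nabla>f) / \<bar>x\<bar>\<^sup>2 + b f / \<bar>x\<bar>\<^sup>2\<close>, which up to sign is the formal adjoint of the
  operator \<open>- \<triangle> + \<alpha> (x \<cdot> \<nabla>) / \<bar>x\<bar>\<^sup>2 + \<beta> / \<bar>x\<bar>\<^sup>2\<close>. Expanding \<open>\<integral>\<bar>T f\<bar>\<^sup>2 \<ge> 0\<close> leaves three
  mixed integrals, of the real inner products of \<open>\<triangle>f\<close> with \<open>x \<cdot> \<nabla>f\<close>, of \<open>\<triangle>f\<close> with \<open>f\<close>, and of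
  \<open>x \<cdot> \<nabla>f\<close> with \<open>f\<close>, with weights \<open>\<bar>x\<bar>\<^sup>-\<^sup>2\<close>, \<open>\<bar>x\<bar>\<^sup>-\<^sup>2\<close> and \<open>\<bar>x\<bar>\<^sup>-\<^sup>4\<close>. Integration by parts turns
  each into the weighted norms on the right-hand side: \<open>rellich_pohozaev_identity\<close>,
  \<open>laplacian_test_identity\<close> and \<open>hardy_identity\<close>. The coefficients then agree identically.

  Integration by parts is the statement that a derivative of a compactly supported function has
  integral zero, \<open>integral_directional_derivative_eq_0\<close>, which follows from translation invariance
  of Lebesgue measure. The weights are singular at the origin only, where \<open>f\<close> vanishes nearby, so
  every integrand is continuous with compact support. The first of the three identities also uses
  the symmetry of second partial derivatives, \<open>partial_commute\<close>.

  The complex plane is treated as a real inner product space throughout: the real part of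
  \<open>z * cnj w\<close> is \<open>z \<bullet> w\<close>.
\<close>

section \<open>Derivatives of compactly supported functions have integral zero\<close>

lemma integrable_of_support:
  fixes h :: "'a::euclidean_space \<Rightarrow> real"
  assumes "compact K" "K \<subseteq> S" "continuous_on S h" "\<And>x. x \<notin> K \<Longrightarrow> h x = 0"
  shows "integrable lborel h"
proof -
  have "integrable lborel (\<lambda>x. indicator K x *\<^sub>R h x)"
    using assms continuous_on_subset by (intro borel_integrable_compact) auto
  also have "(\<lambda>x. indicator K x *\<^sub>R h x) = h"
    using assms(4) by (auto simp: fun_eq_iff indicator_def)
  finally show ?thesis .
qed

text \<open>The integral of \<open>G (x + t e)\<close> over \<open>x\<close> is the same for every \<open>t\<close>, because Lebesgue measure is
  translation invariant, so the difference quotients of \<open>G\<close> in direction \<open>e\<close> integrate to zero.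
  They are bounded by the maximum of \<open>\<bar>G'\<bar>\<close> and, for \<open>0 \<le> t \<le> 1\<close>, live on one compact set; dominated
  convergence passes this to \<open>G'\<close>.\<close>
lemma integral_directional_derivative_eq_0:
  fixes G G' :: "'a::euclidean_space \<Rightarrow> real"
  assumes S: "open S" and K: "compact K" "K \<subseteq> S"
    and contG: "continuous_on S G" and contG': "continuous_on S G'"
    and supp: "\<And>x. x \<notin> K \<Longrightarrow> G x = 0" "\<And>x. x \<notin> K \<Longrightarrow> G' x = 0"
    and deriv: "\<And>x. x \<in> K \<Longrightarrow> ((\<lambda>t. G (x + t *\<^sub>R e)) has_real_derivative G' x) (at 0)"
  shows "(\<integral>x. G' x \<partial>lborel) = 0"
proof -
  have deriv_all: "((\<lambda>t. G (x + t *\<^sub>R e)) has_real_derivative G' x) (at 0)" for x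
  proof (cases "x \<in> K")
    case False
    have "open ((\<lambda>t. x + t *\<^sub>R e) -` (- K))"
      using K(1) by (intro open_vimage) (auto intro!: continuous_intros compact_imp_closed)
    then have "((\<lambda>t. G (x + t *\<^sub>R e)) has_real_derivative 0) (at 0)"
      by (rule has_field_derivative_transform_within_open[OF DERIV_const[of 0]]) (use False supp in auto)
    then show ?thesis using False supp by simp
  qed (rule deriv)
  have line: "((\<lambda>s. G (x + s *\<^sub>R e)) has_real_derivative G' (x + t *\<^sub>R e)) (at t)" for x t
  proof -
    from DERIV_shift[of "\<lambda>s. G (x + s *\<^sub>R e)" "G' (x + t *\<^sub>R e)" 0 t, THEN iffD2]
    show ?thesis using deriv_all[of "x + t *\<^sub>R e"] by (simp add: algebra_simps)
  qed
  have "bounded (G' ` K)"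
    using K contG' continuous_on_subset compact_continuous_image compact_imp_bounded by blast
  then obtain M where M: "M > 0" "\<And>x. x \<in> K \<Longrightarrow> \<bar>G' x\<bar> \<le> M"
    unfolding bounded_pos by auto
  have M_all: "\<bar>G' x\<bar> \<le> M" for x using M supp(2)[of x] by (cases "x \<in> K") auto
  have lip: "\<bar>G (x + t *\<^sub>R e) - G x\<bar> \<le> M * \<bar>t\<bar>" for x t
    using field_differentiable_bound[OF convex_UNIV, of "\<lambda>s. G (x + s *\<^sub>R e)" "\<lambda>t. G' (x + t *\<^sub>R e)" M t 0]
      line M_all by simp
  \<comment> \<open>The points \<open>x\<close> for which the segment from \<open>x\<close> to \<open>x + e\<close> meets \<open>K\<close>.\<close>
  define K' where "K' = (\<lambda>(k, t). k - t *\<^sub>R e) ` (K \<times> {0..1})"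
  have K': "compact K'"
    unfolding K'_def using K(1)
    by (intro compact_continuous_image compact_Times) (auto intro!: continuous_intros simp: case_prod_unfold)
  have outside: "G (x + t *\<^sub>R e) = 0" if "x \<notin> K'" "0 \<le> t" "t \<le> 1" for x t
  proof (rule supp(1), rule notI)
    assume "x + t *\<^sub>R e \<in> K"
    then have "x \<in> K'" unfolding K'_def using that by (intro image_eqI[of _ _ "(x + t *\<^sub>R e, t)"]) auto
    with that show False by simp
  qed
  have intG: "integrable lborel G" by (rule integrable_of_support[OF K contG supp(1)])
  have [measurable]: "G \<in> borel_measurable borel"
    using borel_measurable_integrable[OF intG] by simp
  have [measurable]: "G' \<in> borel_measurable borel"
    using borel_measurable_integrable[OF integrable_of_support[OF K contG' supp(2)]] by simp
  have shift: "integrable lborel (\<lambda>x. G (x + v))" "(\<integral>x. G (x + v) \<partial>lborel) = (\<integral>x. G x \<partial>lborel)" for v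
  proof -
    have "integrable (distr lborel borel ((+) v)) G"
      using intG by (simp add: lborel_distr_plus)
    then show "integrable lborel (\<lambda>x. G (x + v))"
      by (subst (asm) integrable_distr_eq) (auto simp: add.commute)
    have "(\<integral>x. G x \<partial>lborel) = (\<integral>x. G x \<partial>(distr lborel borel ((+) v)))"
      by (simp add: lborel_distr_plus)
    also have "\<dots> = (\<integral>x. G (x + v) \<partial>lborel)"
      by (subst integral_distr) (auto simp: add.commute)
    finally show "(\<integral>x. G (x + v) \<partial>lborel) = (\<integral>x. G x \<partial>lborel)" by simp
  qed
  define h where "h k = 1 / real (Suc k)" for k
  have h: "0 < h k" "h k \<le> 1" for k by (auto simp: h_def)
  have "(\<lambda>k. \<integral>x. (G (x + h k *\<^sub>R e) - G x) / h k \<partial>lborel) \<longlonglongrightarrow> (\<integral>x. G' x \<partial>lborel)"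
  proof (rule integral_dominated_convergence[where w = "\<lambda>x. indicator K' x *\<^sub>R M"])
    show "integrable lborel (\<lambda>x. indicator K' x *\<^sub>R M)"
      using K' by (intro borel_integrable_compact) auto
    show "AE x in lborel. (\<lambda>k. (G (x + h k *\<^sub>R e) - G x) / h k) \<longlonglongrightarrow> G' x"
    proof (rule AE_I2)
      fix x
      have "((\<lambda>t. (G (x + t *\<^sub>R e) - G x) / t) \<longlongrightarrow> G' x) (at 0)"
        using deriv_all[of x] by (simp add: DERIV_def)
      moreover have "filterlim h (at 0) sequentially"
        unfolding filterlim_at h_def using LIMSEQ_inverse_real_of_nat by (auto simp: divide_inverse)
      ultimately show "(\<lambda>k. (G (x + h k *\<^sub>R e) - G x) / h k) \<longlonglongrightarrow> G' x"
        by (rule filterlim_compose)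
    qed
    show "AE x in lborel. norm ((G (x + h k *\<^sub>R e) - G x) / h k) \<le> indicator K' x *\<^sub>R M" for k
    proof (rule AE_I2)
      fix x
      show "norm ((G (x + h k *\<^sub>R e) - G x) / h k) \<le> indicator K' x *\<^sub>R M"
      proof (cases "x \<in> K'")
        case True
        then show ?thesis using lip[of x "h k"] h[of k] by (simp add: field_simps)
      next
        case False
        then show ?thesis using outside[of x "h k"] outside[of x 0] h[of k] by simp
      qed
    qed
  qed measurable
  moreover have "(\<integral>x. (G (x + h k *\<^sub>R e) - G x) / h k \<partial>lborel) = 0" for k
    using shift[of "h k *\<^sub>R e"] intG by simp
  ultimately have "(\<lambda>k. 0) \<longlonglongrightarrow> (\<integral>x. G' x \<partial>lborel)" by (simp only:)
  then show ?thesis using LIMSEQ_unique tendsto_const by blast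
qed

section \<open>Symmetry of second partial derivatives\<close>

lemma partial_along_line:
  fixes f :: "real^'n::finite \<Rightarrow> 'b::real_normed_vector"
  assumes "f differentiable at (x + t *\<^sub>R axis i 1)"
  shows "((\<lambda>s. f (x + s *\<^sub>R axis i 1)) has_vector_derivative partial i f (x + t *\<^sub>R axis i 1)) (at t)"
proof -
  let ?e = "axis i 1 :: real^'n" and ?y = "x + t *\<^sub>R axis i 1"
  obtain D where D: "(f has_derivative D) (at ?y)"
    using assms unfolding differentiable_def by blast
  have *: "((\<lambda>s. f (z + s *\<^sub>R ?e)) has_vector_derivative D ?e) (at u)" if "z + u *\<^sub>R ?e = ?y" for z u
  proof -
    have "((\<lambda>s. z + s *\<^sub>R ?e) has_vector_derivative ?e) (at u)"
      by (auto intro!: derivative_eq_intros)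
    then show ?thesis
      using vector_derivative_diff_chain_within[of "\<lambda>s. z + s *\<^sub>R ?e" ?e u UNIV f D] D that
      by (auto simp: o_def intro: has_derivative_at_withinI)
  qed
  have "partial i f ?y = D ?e"
    unfolding partial_def by (rule vector_derivative_at) (rule *, simp)
  with *[of x t] show ?thesis by simp
qed

text \<open>The mean value theorem is used twice, first along \<open>i\<close> and then along \<open>j\<close>. It is available for
  real-valued functions only, hence the inner product with a fixed vector \<open>c\<close>.\<close>
lemma second_difference_mean_value:
  fixes f :: "real^'n::finite \<Rightarrow> 'b::real_inner" and x :: "real^'n"
  assumes h: "0 < h"
    and diff: "\<And>s t. \<lbrakk>0 \<le> s; s \<le> h; 0 \<le> t; t \<le> h\<rbrakk> \<Longrightarrow>
      f differentiable at (x + s *\<^sub>R axis i 1 + t *\<^sub>R axis j 1) \<and>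
      partial i f differentiable at (x + s *\<^sub>R axis i 1 + t *\<^sub>R axis j 1)"
  obtains a b where "0 \<le> a" "a \<le> h" "0 \<le> b" "b \<le> h"
    "(f (x + h *\<^sub>R axis i 1 + h *\<^sub>R axis j 1) - f (x + h *\<^sub>R axis i 1)
        - f (x + h *\<^sub>R axis j 1) + f x) \<bullet> c
      = h\<^sup>2 * (partial j (partial i f) (x + a *\<^sub>R axis i 1 + b *\<^sub>R axis j 1) \<bullet> c)"
proof -
  let ?i = "axis i 1 :: real^'n" and ?j = "axis j 1 :: real^'n"
  define \<phi> where "\<phi> s = (f (x + s *\<^sub>R ?i + h *\<^sub>R ?j) - f (x + s *\<^sub>R ?i)) \<bullet> c" for s
  define \<psi> where "\<psi> s t = partial i f (x + s *\<^sub>R ?i + t *\<^sub>R ?j) \<bullet> c" for s t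
  have d\<phi>: "(\<phi> has_real_derivative \<psi> s h - \<psi> s 0) (at s)" if "0 \<le> s" "s \<le> h" for s
  proof -
    have "((\<lambda>s. f (x + t *\<^sub>R ?j + s *\<^sub>R ?i)) has_vector_derivative partial i f (x + t *\<^sub>R ?j + s *\<^sub>R ?i)) (at s)"
      if "0 \<le> t" "t \<le> h" for t
      by (rule partial_along_line) (use diff[of s t] \<open>0 \<le> s\<close> \<open>s \<le> h\<close> that in \<open>simp add: ac_simps\<close>)
    from this[of h] this[of 0] h
    have "((\<lambda>s. f (x + s *\<^sub>R ?i + h *\<^sub>R ?j) - f (x + s *\<^sub>R ?i)) has_vector_derivative
        partial i f (x + s *\<^sub>R ?i + h *\<^sub>R ?j) - partial i f (x + s *\<^sub>R ?i)) (at s)"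
      by (intro has_vector_derivative_diff) (simp_all add: ac_simps)
    from bounded_linear.has_vector_derivative[OF bounded_linear_inner_left this, of c]
    show ?thesis
      unfolding \<phi>_def \<psi>_def has_real_derivative_iff_has_vector_derivative by (simp add: inner_diff_left)
  qed
  have d\<psi>: "(\<psi> s has_real_derivative partial j (partial i f) (x + s *\<^sub>R ?i + t *\<^sub>R ?j) \<bullet> c) (at t)"
    if "0 \<le> s" "s \<le> h" "0 \<le> t" "t \<le> h" for s t
    using bounded_linear.has_vector_derivative[OF bounded_linear_inner_left partial_along_line, of "partial i f" "x + s *\<^sub>R ?i" t j c]
      diff[of s t] that
    unfolding \<psi>_def has_real_derivative_iff_has_vector_derivative by simp
  obtain a where a: "0 < a" "a < h" "\<phi> h - \<phi> 0 = h * (\<psi> a h - \<psi> a 0)"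
    using MVT2[OF h, of \<phi> "\<lambda>s. \<psi> s h - \<psi> s 0"] d\<phi> by auto
  obtain b where b: "0 < b" "b < h"
    "\<psi> a h - \<psi> a 0 = h * (partial j (partial i f) (x + a *\<^sub>R ?i + b *\<^sub>R ?j) \<bullet> c)"
    using MVT2[OF h, of "\<psi> a" "\<lambda>t. partial j (partial i f) (x + a *\<^sub>R ?i + t *\<^sub>R ?j) \<bullet> c"] d\<psi>[of a] a by auto
  show thesis
  proof (rule that[of a b])
    show "(f (x + h *\<^sub>R ?i + h *\<^sub>R ?j) - f (x + h *\<^sub>R ?i) - f (x + h *\<^sub>R ?j) + f x) \<bullet> c
      = h\<^sup>2 * (partial j (partial i f) (x + a *\<^sub>R ?i + b *\<^sub>R ?j) \<bullet> c)"
      using a(3) b(3) by (simp add: \<phi>_def inner_diff_left inner_add_left power2_eq_square)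
  qed (use a b in auto)
qed

text \<open>The second difference over a small square is unchanged when \<open>i\<close> and \<open>j\<close> are exchanged, so
  the two mixed derivatives take equal values at points arbitrarily near \<open>x\<close>.\<close>
lemma partial_commute:
  fixes f :: "real^'n::finite \<Rightarrow> 'b::real_inner"
  assumes S: "open S" "x \<in> S"
    and df: "\<And>y. y \<in> S \<Longrightarrow> f differentiable at y"
    and dp: "\<And>y k. y \<in> S \<Longrightarrow> partial k f differentiable at y"
    and cont: "\<And>k l. continuous_on S (partial k (partial l f))"
  shows "partial i (partial j f) x = partial j (partial i f) x"
proof -
  \<comment> \<open>Testing against the difference of the two derivatives gives the square of its norm.\<close>
  define c where "c = partial i (partial j f) x - partial j (partial i f) x"
  define F where "F k l y = partial k (partial l f) y \<bullet> c" for k l y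
  have "\<bar>F i j x - F j i x\<bar> \<le> \<epsilon>" if "\<epsilon> > 0" for \<epsilon>
  proof -
    have "isCont (F k l) x" for k l
      using cont[of k l] S unfolding F_def by (intro continuous_intros) (simp add: continuous_on_eq_continuous_at)
    then have "\<forall>\<^sub>F y in nhds x. \<bar>F k l y - F k l x\<bar> < \<epsilon> / 2" for k l
      using that unfolding continuous_at_eps_delta eventually_nhds_metric
      by (metis dist_real_def half_gt_zero)
    moreover have "\<forall>\<^sub>F y in nhds x. y \<in> S" using S by (rule eventually_nhds_in_open)
    ultimately have "\<forall>\<^sub>F y in nhds x. \<bar>F i j y - F i j x\<bar> < \<epsilon> / 2 \<and> \<bar>F j i y - F j i x\<bar> < \<epsilon> / 2 \<and> y \<in> S"
      by (intro eventually_conj) auto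
    then obtain d where d: "d > 0" "\<And>y. dist y x < d \<Longrightarrow>
        \<bar>F i j y - F i j x\<bar> < \<epsilon> / 2 \<and> \<bar>F j i y - F j i x\<bar> < \<epsilon> / 2 \<and> y \<in> S"
      unfolding eventually_nhds_metric by blast
    define h where "h = d / 3"
    have near: "dist (x + s *\<^sub>R axis k 1 + t *\<^sub>R axis l 1) x < d"
      if "0 \<le> s" "s \<le> h" "0 \<le> t" "t \<le> h" for s t and k l :: 'n
    proof -
      have "norm (s *\<^sub>R axis k 1 + t *\<^sub>R axis l 1 :: real^'n) \<le> s + t"
        using norm_triangle_ineq[of "s *\<^sub>R axis k 1 :: real^'n" "t *\<^sub>R axis l 1"] that by simp
      also have "\<dots> < d" using that d(1) by (simp add: h_def)
      finally show ?thesis by (simp add: dist_norm add.assoc)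
    qed
    have h: "h > 0" using d(1) by (simp add: h_def)
    obtain a b where ab: "0 \<le> a" "a \<le> h" "0 \<le> b" "b \<le> h"
      "(f (x + h *\<^sub>R axis i 1 + h *\<^sub>R axis j 1) - f (x + h *\<^sub>R axis i 1)
        - f (x + h *\<^sub>R axis j 1) + f x) \<bullet> c = h\<^sup>2 * F j i (x + a *\<^sub>R axis i 1 + b *\<^sub>R axis j 1)"
      unfolding F_def by (rule second_difference_mean_value[OF h, of f x i j c]) (use near df dp d(2) in blast)+
    obtain a' b' where ab': "0 \<le> a'" "a' \<le> h" "0 \<le> b'" "b' \<le> h"
      "(f (x + h *\<^sub>R axis j 1 + h *\<^sub>R axis i 1) - f (x + h *\<^sub>R axis j 1)
        - f (x + h *\<^sub>R axis i 1) + f x) \<bullet> c = h\<^sup>2 * F i j (x + a' *\<^sub>R axis j 1 + b' *\<^sub>R axis i 1)"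
      unfolding F_def by (rule second_difference_mean_value[OF h, of f x j i c]) (use near df dp d(2) in blast)+
    have "F j i (x + a *\<^sub>R axis i 1 + b *\<^sub>R axis j 1) = F i j (x + a' *\<^sub>R axis j 1 + b' *\<^sub>R axis i 1)"
      using ab(5) ab'(5) h by (simp add: algebra_simps)
    then show ?thesis
      using d(2)[OF near[OF ab(1-4), of i j]] d(2)[OF near[OF ab'(1-4), of j i]] by linarith
  qed
  then have "\<bar>F i j x - F j i x\<bar> \<le> 0" by (rule field_le_epsilon[of _ 0, simplified])
  then have "c \<bullet> c = 0" by (simp add: F_def c_def inner_diff_left)
  then show ?thesis by (simp add: c_def)
qed

section \<open>Derivatives along coordinate lines\<close>

lemma has_real_derivative_inner:
  fixes a b :: "real \<Rightarrow> 'b::real_inner"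
  assumes "(a has_vector_derivative a') (at t)" "(b has_vector_derivative b') (at t)"
  shows "((\<lambda>t. a t \<bullet> b t) has_real_derivative a t \<bullet> b' + a' \<bullet> b t) (at t)"
  using bounded_bilinear.has_vector_derivative[OF bounded_bilinear_inner assms]
  by (simp add: has_real_derivative_iff_has_vector_derivative)

lemma partial_eq_0_of_local:
  assumes "open U" "x \<in> U" "\<And>y. y \<in> U \<Longrightarrow> f y = 0"
  shows "partial i f x = 0"
proof -
  have "open ((\<lambda>t. x + t *\<^sub>R axis i 1) -` U)"
    using assms(1) by (intro open_vimage) (auto intro!: continuous_intros)
  then have "((\<lambda>t. f (x + t *\<^sub>R axis i 1)) has_vector_derivative 0) (at 0)"
    by (rule has_vector_derivative_transform_within_open[OF has_vector_derivative_const[of 0]])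
      (use assms(2,3) in auto)
  then show ?thesis unfolding partial_def by (rule vector_derivative_at)
qed

lemma coordinate_derivative:
  "((\<lambda>t. (x + t *\<^sub>R axis i 1 :: real^'n::finite) $ j) has_real_derivative (if j = i then 1 else 0)) (at 0)"
  by (auto intro!: derivative_eq_intros simp: axis_def)

text \<open>The value at the origin is \<open>0\<close>, which lets the pointwise divergence formulas below hold
  there too.\<close>
definition inv_sq :: "'a::real_normed_vector \<Rightarrow> real" where
  "inv_sq x = inverse ((norm x)\<^sup>2)"

lemma inv_sq_derivative:
  fixes x :: "real^'n::finite"
  assumes "x \<noteq> 0"
  shows "((\<lambda>t. inv_sq (x + t *\<^sub>R axis i 1)) has_real_derivative - 2 * x $ i * (inv_sq x)\<^sup>2) (at 0)"
proof -
  have "((\<lambda>t. x + t *\<^sub>R axis i 1) has_vector_derivative axis i 1) (at 0)"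
    by (auto intro!: derivative_eq_intros)
  from has_real_derivative_inner[OF this this]
  have "((\<lambda>t. (norm (x + t *\<^sub>R axis i 1))\<^sup>2) has_real_derivative 2 * x $ i) (at 0)"
    by (simp add: power2_norm_eq_inner inner_axis inner_axis')
  from DERIV_inverse'[OF this] assms show ?thesis
    unfolding inv_sq_def by (auto elim!: DERIV_cong simp: power2_eq_square)
qed

lemma continuous_on_inv_sq [continuous_intros]: "continuous_on (UNIV - {0}) inv_sq"
  unfolding inv_sq_def by (auto intro!: continuous_intros)

lemma real_dot_eq_0 [simp]: "real_dot x 0 = 0"
  by (simp add: real_dot_def)

lemma sum_inner_real_dot:
  "(\<Sum>i\<in>UNIV. x $ i * (v $ i \<bullet> c)) = real_dot x v \<bullet> c"
  by (simp add: real_dot_def inner_sum_left)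

section \<open>Test functions on the punctured space\<close>

text \<open>A constant of its own, since the simplifier would otherwise rewrite \<open>f x\<close> inside the
  set that appears in the condition of the rule \<open>x \<notin> support f \<Longrightarrow> f x = 0\<close>.\<close>
definition support :: "('a::topological_space \<Rightarrow> 'b::zero) \<Rightarrow> 'a set" where
  "support f = closure {x. f x \<noteq> 0}"

context
  fixes f :: "real^'n::finite \<Rightarrow> complex"
  assumes f: "f \<in> test_functions (UNIV - {0})"
begin

abbreviation (input) "punctured \<equiv> UNIV - {0 :: real^'n}"
abbreviation (input) "euler x \<equiv> real_dot x (gradient f x)"

lemma compact_supp: "compact (support f)" and supp_subset: "support f \<subseteq> punctured"
  using f by (auto simp: test_functions_def support_def)

lemma differentiable_test: "x \<noteq> 0 \<Longrightarrow> f differentiable at x"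
  and differentiable_partial: "x \<noteq> 0 \<Longrightarrow> partial i f differentiable at x"
  and continuous_partial2: "continuous_on punctured (partial i (partial j f))"
proof -
  have "Ck_on 2 punctured f" using f by (auto simp: test_functions_def smooth_on_def)
  then show "x \<noteq> 0 \<Longrightarrow> f differentiable at x" "x \<noteq> 0 \<Longrightarrow> partial i f differentiable at x"
    "continuous_on punctured (partial i (partial j f))"
    by (auto simp: numeral_2_eq_2)
qed

lemma continuous_test: "continuous_on punctured f"
  and continuous_partial: "continuous_on punctured (partial i f)"
  using differentiable_test differentiable_partial
  by (auto intro!: continuous_at_imp_continuous_on differentiable_imp_continuous_within)

lemma continuous_gradient: "continuous_on punctured (gradient f)"
  unfolding gradient_def[abs_def] by (intro continuous_on_vec_lambda continuous_partial)

lemma continuous_euler: "continuous_on punctured (\<lambda>x. euler x)"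
  unfolding real_dot_def gradient_def by (simp, intro continuous_intros continuous_partial)

lemma continuous_laplacian: "continuous_on punctured (laplacian f)"
  unfolding laplacian_def[abs_def] by (intro continuous_intros continuous_partial2)

lemmas continuous_fields = continuous_intros continuous_test continuous_partial continuous_partial2
  continuous_gradient continuous_euler continuous_laplacian

lemma vanish_off_support:
  assumes "x \<notin> support f"
  shows "f x = 0" "partial i f x = 0" "partial i (partial j f) x = 0"
    "gradient f x = 0" "laplacian f x = 0"
proof -
  have f0: "f y = 0" if "y \<in> - support f" for y using that closure_subset[of "{x. f x \<noteq> 0}"] by (auto simp: support_def)
  have p0: "partial i f y = 0" if "y \<in> - support f" for y i
    by (rule partial_eq_0_of_local[OF _ that f0]) (auto simp: support_def)
  have pp0: "partial i (partial j f) y = 0" if "y \<in> - support f" for y i j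
    by (rule partial_eq_0_of_local[OF _ that p0]) (auto simp: support_def)
  show "f x = 0" "partial i f x = 0" "partial i (partial j f) x = 0"
    "gradient f x = 0" "laplacian f x = 0"
    using assms by (simp_all add: f0 p0 pp0 gradient_def laplacian_def vec_eq_iff)
qed

lemma integrable_test:
  assumes "continuous_on punctured h" "\<And>x. x \<notin> support f \<Longrightarrow> h x = 0"
  shows "integrable lborel (h :: _ \<Rightarrow> real)"
  by (rule integrable_of_support[OF compact_supp supp_subset assms])

lemma integrable_fields:
  "integrable lborel (\<lambda>x. laplacian f x \<bullet> laplacian f x)"
  "integrable lborel (\<lambda>x. inv_sq x * (gradient f x \<bullet> gradient f x))"
  "integrable lborel (\<lambda>x. inv_sq x * (laplacian f x \<bullet> euler x))"
  "integrable lborel (\<lambda>x. inv_sq x * (laplacian f x \<bullet> f x))"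
  "integrable lborel (\<lambda>x. (inv_sq x)\<^sup>2 * (euler x \<bullet> euler x))"
  "integrable lborel (\<lambda>x. (inv_sq x)\<^sup>2 * (euler x \<bullet> f x))"
  "integrable lborel (\<lambda>x. (inv_sq x)\<^sup>2 * (f x \<bullet> f x))"
  by (rule integrable_test; (intro continuous_fields | simp add: vanish_off_support)+)+

text \<open>The divergence theorem for a compactly supported vector field \<open>V\<close> on the punctured space,
  where \<open>V' i\<close> is the \<open>i\<close>-th partial derivative of the component \<open>V i\<close>.\<close>
lemma integral_divergence_eq_0:
  fixes V V' :: "'n \<Rightarrow> real^'n \<Rightarrow> real"
  assumes "\<And>i. continuous_on punctured (V i)" "\<And>i. continuous_on punctured (V' i)"
    and "\<And>i x. x \<notin> support f \<Longrightarrow> V i x = 0" "\<And>i x. x \<notin> support f \<Longrightarrow> V' i x = 0"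
    and "\<And>i x. x \<noteq> 0 \<Longrightarrow> ((\<lambda>t. V i (x + t *\<^sub>R axis i 1)) has_real_derivative V' i x) (at 0)"
  shows "(\<integral>x. (\<Sum>i\<in>UNIV. V' i x) \<partial>lborel) = 0"
proof -
  have "x \<noteq> 0" if "x \<in> support f" for x using that supp_subset by auto
  then have "(\<integral>x. V' i x \<partial>lborel) = 0" for i
    by (intro integral_directional_derivative_eq_0[of punctured "support f" "V i" "V' i" "axis i 1"]
        open_delete open_UNIV compact_supp supp_subset assms) auto
  then show ?thesis using assms by (subst Bochner_Integration.integral_sum) (auto intro: integrable_test)
qed

lemma partial_symmetric: "x \<noteq> 0 \<Longrightarrow> partial i (partial j f) x = partial j (partial i f) x"
  by (rule partial_commute[of punctured])
    (use differentiable_test differentiable_partial continuous_partial2 in auto)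

lemma test_derivative:
  "x \<noteq> 0 \<Longrightarrow> ((\<lambda>t. f (x + t *\<^sub>R axis i 1)) has_vector_derivative partial i f x) (at 0)"
  using partial_along_line[of f x 0 i] differentiable_test by simp

lemma partial_derivative:
  "x \<noteq> 0 \<Longrightarrow> ((\<lambda>t. partial j f (x + t *\<^sub>R axis i 1)) has_vector_derivative partial i (partial j f) x) (at 0)"
  using partial_along_line[of "partial j f" x 0 i] differentiable_partial by simp

text \<open>Product rule for \<open>\<Sum>\<^sub>j x\<^sub>j \<partial>\<^sub>j f\<close>: the coordinate \<open>x\<^sub>i\<close> contributes \<open>\<partial>\<^sub>i f\<close>.\<close>
lemma euler_derivative:
  assumes "x \<noteq> 0"
  shows "((\<lambda>t. euler (x + t *\<^sub>R axis i 1)) has_vector_derivative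
    partial i f x + real_dot x (\<chi> j. partial i (partial j f) x)) (at 0)"
proof -
  have "((\<lambda>t. (x + t *\<^sub>R axis i 1) $ j *\<^sub>R partial j f (x + t *\<^sub>R axis i 1)) has_vector_derivative
      x $ j *\<^sub>R partial i (partial j f) x + (if j = i then 1 else 0) *\<^sub>R partial j f x) (at 0)" for j
    using has_vector_derivative_scaleR[OF coordinate_derivative partial_derivative[OF assms], where i1=i, of x i j] by simp
  then have "((\<lambda>t. euler (x + t *\<^sub>R axis i 1)) has_vector_derivative
      (\<Sum>j\<in>UNIV. x $ j *\<^sub>R partial i (partial j f) x + (if j = i then 1 else 0) *\<^sub>R partial j f x)) (at 0)"
    unfolding real_dot_def gradient_def vec_lambda_beta by (intro has_vector_derivative_sum)
  moreover have "(\<Sum>j\<in>UNIV. (if j = i then 1 else 0) *\<^sub>R partial j f x) = partial i f x"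
    by (simp add: if_distrib[of "\<lambda>c. c *\<^sub>R _"] cong: if_cong)
  ultimately show ?thesis by (simp add: sum.distrib real_dot_def add.commute)
qed

lemma gradient_sq_derivative:
  assumes "x \<noteq> 0"
  shows "((\<lambda>t. gradient f (x + t *\<^sub>R axis i 1) \<bullet> gradient f (x + t *\<^sub>R axis i 1)) has_real_derivative
    2 * (gradient f x \<bullet> (\<chi> j. partial i (partial j f) x))) (at 0)"
proof -
  have "((\<lambda>t. partial j f (x + t *\<^sub>R axis i 1) \<bullet> partial j f (x + t *\<^sub>R axis i 1)) has_real_derivative
      2 * (partial j f x \<bullet> partial i (partial j f) x)) (at 0)" for j
    using has_real_derivative_inner[OF partial_derivative[OF assms] partial_derivative[OF assms], of j i j i]
    by (simp add: inner_commute)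
  then show ?thesis
    unfolding inner_vec_def gradient_def vec_lambda_beta sum_distrib_left by (intro DERIV_sum)
qed

section \<open>Three identities from integration by parts\<close>

lemma sq_norm_eq: "(\<Sum>i\<in>UNIV. x $ i * x $ i) = x \<bullet> (x :: real^'n)"
  by (simp add: inner_vec_def)

lemma inv_sq_inner: "x \<noteq> 0 \<Longrightarrow> inv_sq x * (x \<bullet> x) = 1"
  by (simp add: inv_sq_def power2_norm_eq_inner)

text \<open>The field is \<open>x \<bar>f\<bar>\<^sup>2 / \<bar>x\<bar>\<^sup>4\<close>. The divergence of \<open>x / \<bar>x\<bar>\<^sup>4\<close> is \<open>(n - 4) / \<bar>x\<bar>\<^sup>4\<close>, and
  \<open>x \<cdot> \<nabla>\<bar>f\<bar>\<^sup>2\<close> is twice the real inner product of \<open>x \<cdot> \<nabla>f\<close> with \<open>f\<close>.\<close>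
lemma hardy_identity:
  "(\<integral>x. (inv_sq x)\<^sup>2 * (euler x \<bullet> f x) \<partial>lborel)
    = - (real CARD('n) - 4) / 2 * (\<integral>x. (inv_sq x)\<^sup>2 * (f x \<bullet> f x) \<partial>lborel)"
proof -
  let ?V' = "\<lambda>i x. (inv_sq x)\<^sup>2 * (f x \<bullet> f x) + 2 * (x $ i) * (inv_sq x)\<^sup>2 * (partial i f x \<bullet> f x)
     - 4 * (x $ i * x $ i) * (inv_sq x)^3 * (f x \<bullet> f x)"
  have "(\<integral>x. (\<Sum>i\<in>UNIV. ?V' i x) \<partial>lborel) = 0"
  proof (rule integral_divergence_eq_0[of "\<lambda>i x. x $ i * ((inv_sq x)\<^sup>2 * (f x \<bullet> f x))"])
    fix i :: 'n and x :: "real^'n" assume x: "x \<noteq> 0"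
    show "((\<lambda>t. (x + t *\<^sub>R axis i 1) $ i * ((inv_sq (x + t *\<^sub>R axis i 1))\<^sup>2
        * (f (x + t *\<^sub>R axis i 1) \<bullet> f (x + t *\<^sub>R axis i 1)))) has_real_derivative ?V' i x) (at 0)"
      by (rule DERIV_cong[OF DERIV_mult[OF coordinate_derivative[of x i i] DERIV_mult[OF
          DERIV_power[OF inv_sq_derivative[OF x, of i], of 2]
          has_real_derivative_inner[OF test_derivative[OF x, of i] test_derivative[OF x, of i]]]]])
        (simp add: algebra_simps inner_commute power2_eq_square power3_eq_cube)
  qed (intro continuous_fields | simp add: vanish_off_support)+
  also have "(\<lambda>x. \<Sum>i\<in>UNIV. ?V' i x) =
    (\<lambda>x. (real CARD('n) - 4) * ((inv_sq x)\<^sup>2 * (f x \<bullet> f x)) + 2 * ((inv_sq x)\<^sup>2 * (euler x \<bullet> f x)))"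
  proof
    fix x :: "real^'n"
    show "(\<Sum>i\<in>UNIV. ?V' i x) =
      (real CARD('n) - 4) * ((inv_sq x)\<^sup>2 * (f x \<bullet> f x)) + 2 * ((inv_sq x)\<^sup>2 * (euler x \<bullet> f x))"
    proof (cases "x = 0")
      case True
      then show ?thesis by (simp add: inv_sq_def)
    next
      case False
      have "(\<Sum>i\<in>UNIV. ?V' i x) = real CARD('n) * ((inv_sq x)\<^sup>2 * (f x \<bullet> f x))
          + 2 * (inv_sq x)\<^sup>2 * (\<Sum>i\<in>UNIV. x $ i * (gradient f x $ i \<bullet> f x))
          - 4 * (\<Sum>i\<in>UNIV. x $ i * x $ i) * (inv_sq x)^3 * (f x \<bullet> f x)"
        by (simp add: sum.distrib sum_subtractf sum_distrib_left sum_distrib_right gradient_def mult_ac)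
      also have "\<dots> = real CARD('n) * ((inv_sq x)\<^sup>2 * (f x \<bullet> f x)) + 2 * (inv_sq x)\<^sup>2 * (euler x \<bullet> f x)
          - 4 * (inv_sq x * (x \<bullet> x)) * ((inv_sq x)\<^sup>2 * (f x \<bullet> f x))"
        unfolding sum_inner_real_dot sq_norm_eq by (simp add: power2_eq_square power3_eq_cube)
      finally show ?thesis using inv_sq_inner[OF False] by (simp add: algebra_simps)
    qed
  qed
  finally show ?thesis
    by (simp add: integrable_fields) (simp add: field_simps)
qed

text \<open>The field has \<open>i\<close>-th component \<open>(\<partial>\<^sub>i f \<bullet> f) / \<bar>x\<bar>\<^sup>2\<close>; the last integral comes from
  \<open>\<nabla>(\<bar>x\<bar>\<^sup>-\<^sup>2) = -2 x / \<bar>x\<bar>\<^sup>4\<close>.\<close>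
lemma laplacian_test_identity:
  "(\<integral>x. inv_sq x * (laplacian f x \<bullet> f x) \<partial>lborel)
    = - (\<integral>x. inv_sq x * (gradient f x \<bullet> gradient f x) \<partial>lborel)
      + 2 * (\<integral>x. (inv_sq x)\<^sup>2 * (euler x \<bullet> f x) \<partial>lborel)"
proof -
  let ?V' = "\<lambda>i x. inv_sq x * (partial i (partial i f) x \<bullet> f x) + inv_sq x * (partial i f x \<bullet> partial i f x)
     - 2 * (inv_sq x)\<^sup>2 * (x $ i * (gradient f x $ i \<bullet> f x))"
  have "(\<integral>x. (\<Sum>i\<in>UNIV. ?V' i x) \<partial>lborel) = 0"
  proof (rule integral_divergence_eq_0[of "\<lambda>i x. inv_sq x * (partial i f x \<bullet> f x)"])
    fix i :: 'n and x :: "real^'n" assume x: "x \<noteq> 0"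
    show "((\<lambda>t. inv_sq (x + t *\<^sub>R axis i 1)
        * (partial i f (x + t *\<^sub>R axis i 1) \<bullet> f (x + t *\<^sub>R axis i 1))) has_real_derivative ?V' i x) (at 0)"
      by (rule DERIV_cong[OF DERIV_mult[OF inv_sq_derivative[OF x, of i]
          has_real_derivative_inner[OF partial_derivative[OF x, of i i] test_derivative[OF x, of i]]]])
        (simp add: algebra_simps gradient_def)
  qed (intro continuous_fields | simp add: vanish_off_support)+
  also have "(\<lambda>x. \<Sum>i\<in>UNIV. ?V' i x) =
    (\<lambda>x. inv_sq x * (laplacian f x \<bullet> f x) + inv_sq x * (gradient f x \<bullet> gradient f x)
      - 2 * ((inv_sq x)\<^sup>2 * (euler x \<bullet> f x)))"
    by (simp add: sum.distrib sum_subtractf sum_distrib_left[symmetric] sum_inner_real_dot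
        laplacian_def inner_sum_left inner_vec_def mult.assoc)
      (simp add: gradient_def)
  finally show ?thesis
    by (simp add: integrable_fields)
qed

text \<open>The field has \<open>i\<close>-th component
  \<open>(\<partial>\<^sub>i f \<bullet> (x \<cdot> \<nabla>f)) / \<bar>x\<bar>\<^sup>2 - x\<^sub>i \<bar>\<nabla>f\<bar>\<^sup>2 / (2 \<bar>x\<bar>\<^sup>2)\<close>. The first part produces
  \<open>\<triangle>f \<bullet> (x \<cdot> \<nabla>f)\<close> along with a term in the second derivatives,
  \<open>\<Sum>\<^sub>i\<^sub>j x\<^sub>j (\<partial>\<^sub>i f \<bullet> \<partial>\<^sub>i \<partial>\<^sub>j f)\<close>; the second part cancels that term, since it equals
  \<open>(x \<cdot> \<nabla>\<bar>\<nabla>f\<bar>\<^sup>2) / 2\<close> by the symmetry of second derivatives.\<close>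
lemma rellich_pohozaev_identity:
  "(\<integral>x. inv_sq x * (laplacian f x \<bullet> euler x) \<partial>lborel)
    = (real CARD('n) - 4) / 2 * (\<integral>x. inv_sq x * (gradient f x \<bullet> gradient f x) \<partial>lborel)
      + 2 * (\<integral>x. (inv_sq x)\<^sup>2 * (euler x \<bullet> euler x) \<partial>lborel)"
proof -
  let ?H = "\<lambda>i x. (\<chi> j. partial i (partial j f) x)"
  let ?G = "\<lambda>x. gradient f x \<bullet> gradient f x"
  let ?V' = "\<lambda>i x. inv_sq x * (partial i (partial i f) x \<bullet> euler x) + inv_sq x * (partial i f x \<bullet> partial i f x)
     + inv_sq x * (partial i f x \<bullet> real_dot x (?H i x)) - 2 * (inv_sq x)\<^sup>2 * (x $ i * (gradient f x $ i \<bullet> euler x))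
     - (inv_sq x * ?G x / 2 + inv_sq x * (x $ i * (gradient f x \<bullet> ?H i x)) - (x $ i * x $ i) * ((inv_sq x)\<^sup>2 * ?G x))"
  have "(\<integral>x. (\<Sum>i\<in>UNIV. ?V' i x) \<partial>lborel) = 0"
  proof (rule integral_divergence_eq_0[of "\<lambda>i x. inv_sq x * (partial i f x \<bullet> euler x) - x $ i * (inv_sq x * (?G x / 2))"])
    fix i :: 'n and x :: "real^'n" assume x: "x \<noteq> 0"
    show "((\<lambda>t. inv_sq (x + t *\<^sub>R axis i 1) * (partial i f (x + t *\<^sub>R axis i 1) \<bullet> euler (x + t *\<^sub>R axis i 1))
        - (x + t *\<^sub>R axis i 1) $ i * (inv_sq (x + t *\<^sub>R axis i 1) * (?G (x + t *\<^sub>R axis i 1) / 2)))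
        has_real_derivative ?V' i x) (at 0)"
      by (rule DERIV_cong[OF DERIV_diff[OF
          DERIV_mult[OF inv_sq_derivative[OF x, of i]
            has_real_derivative_inner[OF partial_derivative[OF x, of i i] euler_derivative[OF x, of i]]]
          DERIV_mult[OF coordinate_derivative[of x i i]
            DERIV_mult[OF inv_sq_derivative[OF x, of i] DERIV_cdivide[OF gradient_sq_derivative[OF x, of i], of 2]]]]])
        (simp add: algebra_simps inner_add_right power2_eq_square, simp add: gradient_def)
  next
    fix i
    have "continuous_on punctured (?H i)"
      by (intro continuous_on_vec_lambda continuous_partial2)
    moreover have "continuous_on punctured (\<lambda>x. real_dot x (?H i x))"
      unfolding real_dot_def by (simp, intro continuous_intros continuous_partial2)
    ultimately show "continuous_on punctured (?V' i)"
      by (intro continuous_fields) simp_all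
  qed (intro continuous_fields | simp add: vanish_off_support)+
  also have "(\<lambda>x. \<Sum>i\<in>UNIV. ?V' i x) =
    (\<lambda>x. inv_sq x * (laplacian f x \<bullet> euler x) - (real CARD('n) - 4) / 2 * (inv_sq x * ?G x)
      - 2 * ((inv_sq x)\<^sup>2 * (euler x \<bullet> euler x)))"
  proof
    fix x :: "real^'n"
    show "(\<Sum>i\<in>UNIV. ?V' i x) =
      inv_sq x * (laplacian f x \<bullet> euler x) - (real CARD('n) - 4) / 2 * (inv_sq x * ?G x)
      - 2 * ((inv_sq x)\<^sup>2 * (euler x \<bullet> euler x))"
    proof (cases "x = 0")
      case True
      then show ?thesis by (simp add: inv_sq_def)
    next
      case False
      have sym: "(\<Sum>i\<in>UNIV. partial i f x \<bullet> real_dot x (?H i x)) = (\<Sum>i\<in>UNIV. x $ i * (gradient f x \<bullet> ?H i x))"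
      proof -
        have "(\<Sum>i\<in>UNIV. partial i f x \<bullet> real_dot x (?H i x))
          = (\<Sum>i\<in>UNIV. \<Sum>j\<in>UNIV. x $ j * (partial i f x \<bullet> partial j (partial i f) x))"
          by (simp add: real_dot_def inner_sum_right partial_symmetric[OF False, of _ _])
        also have "\<dots> = (\<Sum>j\<in>UNIV. \<Sum>i\<in>UNIV. x $ j * (partial i f x \<bullet> partial j (partial i f) x))"
          by (rule sum.swap)
        finally show ?thesis
          by (simp add: inner_vec_def gradient_def sum_distrib_left)
      qed
      have "(\<Sum>i\<in>UNIV. ?V' i x) = inv_sq x * (\<Sum>i\<in>UNIV. partial i (partial i f) x \<bullet> euler x)
          + inv_sq x * (\<Sum>i\<in>UNIV. partial i f x \<bullet> partial i f x)
          + inv_sq x * (\<Sum>i\<in>UNIV. partial i f x \<bullet> real_dot x (?H i x))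
          - 2 * (inv_sq x)\<^sup>2 * (\<Sum>i\<in>UNIV. x $ i * (gradient f x $ i \<bullet> euler x))
          - (real CARD('n) * (inv_sq x * ?G x / 2) + inv_sq x * (\<Sum>i\<in>UNIV. x $ i * (gradient f x \<bullet> ?H i x))
            - (\<Sum>i\<in>UNIV. x $ i * x $ i) * ((inv_sq x)\<^sup>2 * ?G x))"
        unfolding sum_distrib_left sum_distrib_right by (simp add: sum.distrib sum_subtractf)
      also have "\<dots> = inv_sq x * (laplacian f x \<bullet> euler x) + inv_sq x * ?G x
          - 2 * ((inv_sq x)\<^sup>2 * (euler x \<bullet> euler x)) - real CARD('n) / 2 * (inv_sq x * ?G x)
          + (inv_sq x * (x \<bullet> x)) * (inv_sq x * ?G x)"
        unfolding sum_inner_real_dot sq_norm_eq sym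
        by (simp add: laplacian_def inner_sum_left inner_vec_def gradient_def power2_eq_square)
      finally show ?thesis using inv_sq_inner[OF False] by (simp add: field_simps)
    qed
  qed
  finally show ?thesis
    by (simp add: integrable_fields)
qed

section \<open>The inequality\<close>

text \<open>Expand \<open>\<integral>\<bar>T f\<bar>\<^sup>2 \<ge> 0\<close> for \<open>T f = \<triangle>f + a (x \<cdot> \<nabla>f) / \<bar>x\<bar>\<^sup>2 + b f / \<bar>x\<bar>\<^sup>2\<close> and
  replace the three mixed integrals by the identities above.\<close>
lemma laplacian_lower_bound:
  fixes a b :: real
  defines "n \<equiv> real CARD('n)"
  shows "(\<integral>x. laplacian f x \<bullet> laplacian f x \<partial>lborel) \<ge>
      (2 * b - a * (n - 4)) * (\<integral>x. inv_sq x * (gradient f x \<bullet> gradient f x) \<partial>lborel)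
    - a * (a + 4) * (\<integral>x. (inv_sq x)\<^sup>2 * (euler x \<bullet> euler x) \<partial>lborel)
    + b * ((n - 4) * (a + 2) - b) * (\<integral>x. (inv_sq x)\<^sup>2 * (f x \<bullet> f x) \<partial>lborel)"
proof -
  let ?T = "\<lambda>x. laplacian f x + (a * inv_sq x) *\<^sub>R euler x + (b * inv_sq x) *\<^sub>R f x"
  have "?T x \<bullet> ?T x = laplacian f x \<bullet> laplacian f x + a\<^sup>2 * ((inv_sq x)\<^sup>2 * (euler x \<bullet> euler x))
      + b\<^sup>2 * ((inv_sq x)\<^sup>2 * (f x \<bullet> f x)) + 2 * a * (inv_sq x * (laplacian f x \<bullet> euler x))
      + 2 * b * (inv_sq x * (laplacian f x \<bullet> f x)) + 2 * a * b * ((inv_sq x)\<^sup>2 * (euler x \<bullet> f x))" for x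
    by (simp add: inner_add_left inner_add_right inner_commute power2_eq_square algebra_simps)
  then have "0 \<le> (\<integral>x. laplacian f x \<bullet> laplacian f x + a\<^sup>2 * ((inv_sq x)\<^sup>2 * (euler x \<bullet> euler x))
      + b\<^sup>2 * ((inv_sq x)\<^sup>2 * (f x \<bullet> f x)) + 2 * a * (inv_sq x * (laplacian f x \<bullet> euler x))
      + 2 * b * (inv_sq x * (laplacian f x \<bullet> f x)) + 2 * a * b * ((inv_sq x)\<^sup>2 * (euler x \<bullet> f x)) \<partial>lborel)"
    by (metis (no_types, lifting) Bochner_Integration.integral_nonneg inner_ge_zero)
  also have "\<dots> = (\<integral>x. laplacian f x \<bullet> laplacian f x \<partial>lborel)
      + a\<^sup>2 * (\<integral>x. (inv_sq x)\<^sup>2 * (euler x \<bullet> euler x) \<partial>lborel)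
      + b\<^sup>2 * (\<integral>x. (inv_sq x)\<^sup>2 * (f x \<bullet> f x) \<partial>lborel)
      + 2 * a * (\<integral>x. inv_sq x * (laplacian f x \<bullet> euler x) \<partial>lborel)
      + 2 * b * (\<integral>x. inv_sq x * (laplacian f x \<bullet> f x) \<partial>lborel)
      + 2 * a * b * (\<integral>x. (inv_sq x)\<^sup>2 * (euler x \<bullet> f x) \<partial>lborel)"
    by (simp add: integrable_fields)
  finally show ?thesis
    unfolding rellich_pohozaev_identity laplacian_test_identity hardy_identity n_def
    by (simp add: field_simps power2_eq_square)
qed

end

lemma L2_norm_sq: "(L2_norm g)\<^sup>2 = (\<integral>x. (norm (g x))\<^sup>2 \<partial>lborel)"
  unfolding L2_norm_def by (rule real_sqrt_pow2) (simp add: Bochner_Integration.integral_nonneg)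

theorem corollary5p2:
  fixes \<alpha> \<beta> n :: real and f :: "real^'n::finite \<Rightarrow> complex"
  defines "n \<equiv> real CARD('n)"
  assumes "CARD('n) \<ge> 2"
    and "f \<in> test_functions (UNIV - {0})"
  shows "(L2_norm (laplacian f))\<^sup>2 \<ge>
      (n * \<alpha> - 2 * \<beta>) * (L2_norm (\<lambda>x. gradient f x /\<^sub>R norm x))\<^sup>2
    - \<alpha> * (\<alpha> + 4) * (L2_norm (\<lambda>x. real_dot x (gradient f x) /\<^sub>R (norm x)\<^sup>2))\<^sup>2
    + (2 * (n - 4) * (\<alpha> * (n - 2) - \<beta>) - 2 * \<alpha>\<^sup>2 * (n - 2) + \<alpha> * \<beta> * n - \<beta>\<^sup>2)
        * (L2_norm (\<lambda>x. f x /\<^sub>R (norm x)\<^sup>2))\<^sup>2"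
proof -
  \<comment> \<open>This choice makes the operator the formal adjoint, up to sign, of
    \<open>- \<triangle> + \<alpha> (x \<cdot> \<nabla>) / \<bar>x\<bar>\<^sup>2 + \<beta> / \<bar>x\<bar>\<^sup>2\<close>, because the divergence of \<open>x / \<bar>x\<bar>\<^sup>2\<close> is
    \<open>(n - 2) / \<bar>x\<bar>\<^sup>2\<close>.\<close>
  define b where "b = \<alpha> * (n - 2) - \<beta>"
  have "2 * b - \<alpha> * (n - 4) = n * \<alpha> - 2 * \<beta>"
    by (simp add: b_def algebra_simps)
  moreover have "b * ((n - 4) * (\<alpha> + 2) - b)
      = 2 * (n - 4) * (\<alpha> * (n - 2) - \<beta>) - 2 * \<alpha>\<^sup>2 * (n - 2) + \<alpha> * \<beta> * n - \<beta>\<^sup>2"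
    by (simp add: b_def algebra_simps power2_eq_square)
  moreover have "(norm (v /\<^sub>R norm x))\<^sup>2 = inv_sq x * (v \<bullet> v)"
    "(norm (c /\<^sub>R (norm x)\<^sup>2))\<^sup>2 = (inv_sq x)\<^sup>2 * (c \<bullet> c)" for x :: "real^'n" and v :: "complex^'n" and c :: complex
    by (simp_all add: inv_sq_def power_mult_distrib power2_norm_eq_inner[symmetric] power_inverse)
  ultimately show ?thesis
    using laplacian_lower_bound[OF assms(3), of b \<alpha>]
    unfolding L2_norm_sq n_def[symmetric] by (simp add: power2_norm_eq_inner)
qed

end
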